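(* Suppose that $\mathbb{X}$ is finite and $f:\mathbb{X}\to\mathbb{Y}^*$ is complete fix-free, with $f(\mathbb{X})\neq\{\lambda\}$. Then (i) $f^{\mathbb{Z}}$ is a bijection $\mathbb{X}^{\mathbb{Z}}\to\mathbb{Y}^{\mathbb{Z}}$, and (ii) $\mu=\nu\circ f^{\mathbb{Z}}$, i.e. $\mu(A)=\nu(f^{\mathbb{Z}}(A))$, is a stationary measure on $(\mathbb{X}^{\mathbb{Z}},\mathcal{X}^{\mathbb{Z}})$ if $\nu$ is a stationary measure on $(\mathbb{Y}^{\mathbb{Z}},\mathcal{Y}^{\mathbb{Z}})$.
   Context: $\mathbb{Y}$ is a finite alphabet of cardinality $|\mathbb{Y}|$; $\mathbb{Y}^+$ is the set of nonempty finite strings over $\mathbb{Y}$, $\mathbb{Y}^*=\mathbb{Y}^+\cup\{\lambda\}$ with $\lambda$ the empty string; $|w|$ is the length of a string $w$. $(\mathbb{X}^{\mathbb{Z}},\mathcal{X}^{\mathbb{Z}})$, $(\mathbb{Y}^{\mathbb{Z}},\mathcal{Y}^{\mathbb{Z}})$ are the spaces of two-sided sequences with product $\sigma$-algebras; "measure" means probability measure; a measure is stationary if it is invariant under the shift $T((x_i)_{i\in\mathbb{Z}})=(x_{i+1})_{i\in\mathbb{Z}}$. A set $\mathcal{L}\subset\mathbb{Y}^*$ is prefix-free if $w\ne zs$ for all $w,z\in\mathcal{L}$, $s\in\mathbb{Y}^+$; suffix-free if $w\neq sz$ for all $w,z\in\mathcal{L}$, $s\in\mathbb{Y}^+$; fix-free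 if it is both; complete if $\sum_{w\in\mathcal{L}}|\mathbb{Y}|^{-|w|}=1$. A function $f:\mathbb{X}\to\mathbb{Y}^*$ is complete fix-free if $f$ is an injection and $f(\mathbb{X})$ is complete and fix-free. $f^{\mathbb{Z}}(x^{\mathbb{Z}})=\dots f(x_{-1})f(x_0)\mathbf{.}f(x_1)f(x_2)\dots$ is the two-sided concatenation ($f(x_1)$ starts at coordinate $1$). *)

theory Defs
  imports "HOL-Probability.Probability"
begin

text \<open>Alphabets are finite types, strings are lists, two-sided sequences are functions on \<^typ>\<open>int\<close>.\<close>

definition prefix_free :: "'a list set \<Rightarrow> bool" where
  "prefix_free L \<longleftrightarrow> (\<forall>w\<in>L. \<forall>z\<in>L. \<forall>s. s \<noteq> [] \<longrightarrow> w \<noteq> z @ s)"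

definition suffix_free :: "'a list set \<Rightarrow> bool" where
  "suffix_free L \<longleftrightarrow> (\<forall>w\<in>L. \<forall>z\<in>L. \<forall>s. s \<noteq> [] \<longrightarrow> w \<noteq> s @ z)"

definition fix_free :: "'a list set \<Rightarrow> bool" where
  "fix_free L \<longleftrightarrow> prefix_free L \<and> suffix_free L"

definition complete_strings :: "'a::finite list set \<Rightarrow> bool" where
  "complete_strings L \<longleftrightarrow>
     ((\<lambda>w. real CARD('a) powi (- int (length w))) has_sum 1) L"

definition complete_fix_free :: "('x \<Rightarrow> 'y::finite list) \<Rightarrow> bool" where
  "complete_fix_free f \<longleftrightarrow> inj f \<and> complete_strings (range f) \<and> fix_free (range f)"

text \<open>Coordinate at which the block \<open>f (x i)\<close> begins in the two-sided concatenation. Block 1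
  begins at coordinate 1; for each \<open>i\<close> at most one of the two sums is nonempty.\<close>

definition block_start :: "('x \<Rightarrow> 'y list) \<Rightarrow> (int \<Rightarrow> 'x) \<Rightarrow> int \<Rightarrow> int" where
  "block_start f x i =
     1 + (\<Sum>j\<in>{1..<i}. int (length (f (x j)))) - (\<Sum>j\<in>{i..<1}. int (length (f (x j))))"

lemma block_start_1: "block_start f x 1 = 1"
  by (simp add: block_start_def)

lemma block_start_step: "block_start f x (i + 1) = block_start f x i + int (length (f (x i)))"
proof (cases "1 \<le> i")
  case True
  then have "{1..<i + 1} = insert i {1..<i}" "{i + 1..<1} = {}" "{i..<1} = {}" by auto
  then show ?thesis by (simp add: block_start_def)
next
  case False
  then have "{i..<1} = insert i {i + 1..<1}" "{1..<i + 1} = {}" "{1..<i} = {}" by auto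
  then show ?thesis by (simp add: block_start_def)
qed

text \<open>The two-sided concatenation: coordinate \<open>n\<close> lies in the unique block \<open>i\<close> that covers it.
  Such a block exists for every \<open>n\<close> whenever infinitely many blocks are nonempty in each direction;
  otherwise the value outside the covered coordinates is unspecified.\<close>

definition two_sided_concat :: "('x \<Rightarrow> 'y list) \<Rightarrow> (int \<Rightarrow> 'x) \<Rightarrow> (int \<Rightarrow> 'y)" where
  "two_sided_concat f x n =
     (let i = (THE i. block_start f x i \<le> n \<and> n < block_start f x (i + 1))
      in f (x i) ! nat (n - block_start f x i))"

definition seq_space :: "(int \<Rightarrow> 'a) measure" where
  "seq_space = PiM UNIV (\<lambda>_. count_space UNIV)"

definition shift :: "(int \<Rightarrow> 'a) \<Rightarrow> (int \<Rightarrow> 'a)" where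
  "shift x = (\<lambda>i. x (i + 1))"

definition stationary_measure :: "(int \<Rightarrow> 'a) measure \<Rightarrow> bool" where
  "stationary_measure M \<longleftrightarrow>
     prob_space M \<and> sets M = sets seq_space \<and>
     (\<forall>A\<in>sets M. emeasure M (shift -` A) = emeasure M A)"

end

theory Submission
  imports Defs "HOL-Library.Sublist"
begin

text \<open>
  Equality in the Kraft sum means that a finite prefix-free code has no gaps: for any \<open>N\<close> at least
  the maximal word length, the sets of strings of length \<open>N\<close> that extend the individual code words
  are disjoint, and their cardinalities add up to the number of all strings of length \<open>N\<close>. Hence every
  sufficiently long string has a code word as a prefix (\<open>complete_prefix_free_covers\<close>), and mirroring gives the same for
  suffixes. So at every coordinate \<open>n\<close> of a two-sided sequence \<open>y\<close> exactly one code word begins, and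
  exactly one ends just before \<open>n\<close>. Parsing \<open>y\<close> from coordinate 1 to the right by the
  former property and to the left by the latter produces one and only one preimage, \<open>decode y\<close>, under
  the concatenation map.

  The measure \<open>\<mu>\<close> is the image of \<open>\<nu>\<close> under \<open>decode\<close>, which is measurable because each decoded
  symbol depends on \<open>y\<close> through countably many finite observations. For stationarity, shifting the
  decoded sequence by one symbol amounts to shifting \<open>y\<close> by the length of its first code word
  (\<open>shift_decode\<close>). This is a shift by a random amount, but it preserves \<open>\<nu>\<close>: split according to the
  first symbol \<open>a\<close>; on each piece the shift is by the constant \<open>|f a|\<close> and moves the condition
  ``\<open>f a\<close> begins at coordinate 1'' to ``\<open>f a\<close> ends at coordinate 0''. As exactly one word ends at
  coordinate 0, the shifted pieces again form a partition, and their measures add up to the original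
  one (\<open>emeasure_shift_vimage_decode\<close>). The prefix property thus makes the pieces before the shift
  a partition, and the suffix property the pieces after it.
\<close>

section \<open>Complete codes cover all long strings\<close>

text \<open>Counting the strings of the length of \<open>u\<close>: the extensions of a word \<open>w\<close> number
  \<open>q^(|u| - |w|)\<close>, where \<open>q\<close> is the size of the alphabet, so by the Kraft equality the
  disjoint classes of extensions use up all
  \<open>q^|u|\<close> strings, and \<open>u\<close> itself must lie in one of them.\<close>

lemma complete_prefix_free_covers:
  fixes L :: "'a::finite list set"
  assumes "finite L" "prefix_free L" "complete_strings L"
    and len: "\<And>w. w \<in> L \<Longrightarrow> length w \<le> length u"
  shows "\<exists>w\<in>L. prefix w u"
proof -
  define E where "E w = (@) w ` {v :: 'a list. length v = length u - length w}" for w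
  have card_lists: "card {v :: 'a list. length v = n} = CARD('a) ^ n" for n
    using card_lists_length_eq[of "UNIV :: 'a set" n] by simp
  have fin_lists: "finite {v :: 'a list. length v = n}" for n
    using finite_lists_length_eq[of "UNIV :: 'a set" n] by simp
  have card_E: "card (E w) = CARD('a) ^ (length u - length w)" for w
    unfolding E_def by (subst card_image) (auto simp: inj_on_def card_lists)
  have disj: "E w \<inter> E z = {}" if "w \<in> L" "z \<in> L" "w \<noteq> z" for w z
  proof -
    have False if "w @ v = z @ v'" for v v'
    proof -
      from that obtain s where "w = z @ s \<or> z = w @ s"
        by (auto simp: append_eq_append_conv2)
      then show False
        using \<open>prefix_free L\<close> \<open>w \<in> L\<close> \<open>z \<in> L\<close> \<open>w \<noteq> z\<close>
        unfolding prefix_free_def by (metis append_Nil2)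
    qed
    then show ?thesis unfolding E_def by blast
  qed
  have "(\<Sum>w\<in>L. real CARD('a) powi (- int (length w))) = 1"
    using assms unfolding complete_strings_def by (simp add: has_sum_finite_iff)
  then have "real CARD('a) ^ length u
      = (\<Sum>w\<in>L. real CARD('a) ^ length u * real CARD('a) powi (- int (length w)))"
    by (simp flip: sum_distrib_left)
  also have "\<dots> = (\<Sum>w\<in>L. real CARD('a) ^ (length u - length w))"
    by (intro sum.cong refl)
       (simp add: len power_diff power_int_minus field_simps)
  also have "\<dots> = real (\<Sum>w\<in>L. card (E w))"
    by (simp add: card_E)
  also have "(\<Sum>w\<in>L. card (E w)) = card (\<Union>w\<in>L. E w)"
    using \<open>finite L\<close> disj fin_lists
    by (subst card_UN_disjoint) (auto simp: E_def)
  finally have "card (\<Union>w\<in>L. E w) = CARD('a) ^ length u"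
    by (metis of_nat_eq_iff of_nat_power)
  moreover have "(\<Union>w\<in>L. E w) \<subseteq> {v. length v = length u}"
    by (auto simp: E_def dest: len)
  ultimately have "(\<Union>w\<in>L. E w) = {v. length v = length u}"
    by (intro card_subset_eq) (simp_all add: fin_lists card_lists)
  then have "u \<in> (\<Union>w\<in>L. E w)"
    by simp
  then show ?thesis
    by (auto simp: E_def intro: prefixI)
qed

lemma complete_suffix_free_covers:
  fixes L :: "'a::finite list set"
  assumes "finite L" "suffix_free L" "complete_strings L"
    and len: "\<And>w. w \<in> L \<Longrightarrow> length w \<le> length u"
  shows "\<exists>w\<in>L. suffix w u"
proof -
  have "prefix_free (rev ` L)"
    using \<open>suffix_free L\<close> unfolding prefix_free_def suffix_free_def
    by (metis (no_types, lifting) imageE rev_append rev_is_Nil_conv rev_rev_ident)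
  moreover have "complete_strings (rev ` L)"
    using \<open>complete_strings L\<close> unfolding complete_strings_def
    by (subst has_sum_reindex) (auto simp: o_def)
  ultimately have "\<exists>w\<in>rev ` L. prefix w (rev u)"
    using assms by (intro complete_prefix_free_covers) auto
  then show ?thesis
    by (auto simp: suffix_to_prefix)
qed

section \<open>Parsing a two-sided sequence\<close>

definition occurs_at :: "('x \<Rightarrow> 'y list) \<Rightarrow> (int \<Rightarrow> 'y) \<Rightarrow> int \<Rightarrow> 'x \<Rightarrow> bool" where
  "occurs_at f y n a \<longleftrightarrow> (\<forall>k<length (f a). y (n + int k) = f a ! k)"

locale complete_fix_free_code =
  fixes f :: "'x::finite \<Rightarrow> 'y::finite list"
  assumes complete_fix_free: "complete_fix_free f"
    and range_neq: "range f \<noteq> {[]}"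
begin

text \<open>The empty string is a prefix of everything, so a prefix-free code containing it has no other word;
  that case is ruled out by \<open>range_neq\<close>.\<close>

lemma code_nonempty: "f a \<noteq> []"
proof
  assume "f a = []"
  moreover have "prefix_free (range f)"
    using complete_fix_free by (simp add: complete_fix_free_def fix_free_def)
  ultimately have "f b = []" for b
    unfolding prefix_free_def by (metis append_Nil rangeI)
  then have "range f = {[]}" by auto
  with range_neq show False by simp
qed

lemma inj_code: "inj f"
  using complete_fix_free by (simp add: complete_fix_free_def)

lemma prefix_code:
  assumes "prefix (f a) (f b)"
  shows "a = b"
proof -
  obtain s where s: "f b = f a @ s"
    using assms by (auto simp: prefix_def)
  have "prefix_free (range f)"
    using complete_fix_free by (simp add: complete_fix_free_def fix_free_def)
  with s have "s = []"
    unfolding prefix_free_def by blast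
  with s show ?thesis
    using inj_code by (simp add: inj_eq)
qed

lemma suffix_code:
  assumes "suffix (f a) (f b)"
  shows "a = b"
proof -
  obtain s where s: "f b = s @ f a"
    using assms by (auto simp: suffix_def)
  have "suffix_free (range f)"
    using complete_fix_free by (simp add: complete_fix_free_def fix_free_def)
  with s have "s = []"
    unfolding suffix_free_def by blast
  with s show ?thesis
    using inj_code by (simp add: inj_eq)
qed

text \<open>Of two code words beginning at the same coordinate the shorter one is a prefix of the longer one.\<close>

lemma occurs_at_start_unique:
  assumes "occurs_at f y n a" "occurs_at f y n b"
  shows "a = b"
proof -
  have *: "a = b" if "occurs_at f y n a" "occurs_at f y n b" "length (f a) \<le> length (f b)" for a b
  proof (rule prefix_code)
    have "f a = take (length (f a)) (f b)"
      using that by (intro nth_equalityI) (auto simp: occurs_at_def)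
    then show "prefix (f a) (f b)" by (metis take_is_prefix)
  qed
  show ?thesis
    using *[of a b] *[of b a] assms le_cases[of "length (f a)" "length (f b)"] by blast
qed

lemma occurs_at_end_unique:
  assumes "occurs_at f y (n - int (length (f a))) a" "occurs_at f y (n - int (length (f b))) b"
  shows "a = b"
proof -
  have *: "a = b"
    if a: "occurs_at f y (n - int (length (f a))) a"
      and b: "occurs_at f y (n - int (length (f b))) b"
      and le: "length (f a) \<le> length (f b)" for a b
  proof (rule suffix_code)
    have "f a = drop (length (f b) - length (f a)) (f b)"
    proof (rule nth_equalityI)
      fix k assume k: "k < length (f a)"
      \<comment> \<open>The position in the longer word of the letter that is aligned with letter \<open>k\<close> of the shorter one.\<close>
      define m where "m = length (f b) - length (f a) + k"
      have "m < length (f b)"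
        using k le by (simp add: m_def)
      have "f a ! k = y (n - int (length (f a)) + int k)"
        using a k by (simp add: occurs_at_def)
      also have "n - int (length (f a)) + int k = n - int (length (f b)) + int m"
        using le by (simp add: m_def of_nat_diff)
      also have "y (n - int (length (f b)) + int m) = f b ! m"
        using b \<open>m < length (f b)\<close> by (simp only: occurs_at_def)
      finally show "f a ! k = drop (length (f b) - length (f a)) (f b) ! k"
        using le by (simp only: m_def nth_drop)
    qed (use le in simp)
    then show "suffix (f a) (f b)" by (metis suffix_drop)
  qed
  show ?thesis
    using *[of a b] *[of b a] assms le_cases[of "length (f a)" "length (f b)"] by blast
qed

definition max_len :: nat where
  "max_len = Max (range (\<lambda>a. length (f a)))"

lemma length_le_max_len: "length (f a) \<le> max_len"
  unfolding max_len_def by (intro Max_ge) auto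

lemma occurs_at_start_exists: "\<exists>a. occurs_at f y n a"
proof -
  define u where "u = map (\<lambda>k. y (n + int k)) [0..<max_len]"
  have "\<exists>w\<in>range f. prefix w u"
    using complete_fix_free length_le_max_len
    by (intro complete_prefix_free_covers)
       (auto simp: complete_fix_free_def fix_free_def u_def)
  then obtain a v where "u = f a @ v"
    by (auto simp: prefix_def)
  then have "f a ! k = y (n + int k)" if "k < length (f a)" for k
    using that length_le_max_len[of a] nth_append_left[of k "f a" v]
    by (simp add: u_def flip: \<open>u = f a @ v\<close>)
  then have "occurs_at f y n a" by (simp add: occurs_at_def)
  then show ?thesis ..
qed

lemma occurs_at_end_exists: "\<exists>a. occurs_at f y (n - int (length (f a))) a"
proof -
  define u where "u = map (\<lambda>k. y (n - int max_len + int k)) [0..<max_len]"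
  have "\<exists>w\<in>range f. suffix w u"
    using complete_fix_free length_le_max_len
    by (intro complete_suffix_free_covers)
       (auto simp: complete_fix_free_def fix_free_def u_def)
  then obtain a v where u: "u = v @ f a"
    by (auto simp: suffix_def)
  then have len: "length v + length (f a) = max_len"
    by (metis length_append length_map length_upt minus_nat.diff_0 u_def)
  have "f a ! k = y (n - int (length (f a)) + int k)" if "k < length (f a)" for k
  proof -
    have "f a ! k = u ! (length v + k)"
      by (simp add: u)
    also have "\<dots> = y (n - int max_len + int (length v + k))"
      using that len by (simp add: u_def)
    also have "n - int max_len + int (length v + k) = n - int (length (f a)) + int k"
      using len by simp
    finally show ?thesis .
  qed
  then have "occurs_at f y (n - int (length (f a))) a" by (simp add: occurs_at_def)
  then show ?thesis ..
qed

definition symbol_from :: "(int \<Rightarrow> 'y) \<Rightarrow> int \<Rightarrow> 'x" where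
  "symbol_from y n = (THE a. occurs_at f y n a)"

text \<open>The right end \<open>n\<close> is exclusive: the last letter of the word sits at coordinate \<open>n - 1\<close>, so that
  the next word begins at \<open>n\<close>.\<close>

definition symbol_upto :: "(int \<Rightarrow> 'y) \<Rightarrow> int \<Rightarrow> 'x" where
  "symbol_upto y n = (THE a. occurs_at f y (n - int (length (f a))) a)"

lemma symbol_from_eq_iff: "symbol_from y n = a \<longleftrightarrow> occurs_at f y n a"
proof -
  obtain b where b: "occurs_at f y n b"
    using occurs_at_start_exists by blast
  then have "symbol_from y n = b"
    unfolding symbol_from_def by (rule the_equality) (metis b occurs_at_start_unique)
  with b show ?thesis by (metis occurs_at_start_unique)
qed

lemma symbol_upto_eq_iff: "symbol_upto y n = a \<longleftrightarrow> occurs_at f y (n - int (length (f a))) a"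
proof -
  obtain b where b: "occurs_at f y (n - int (length (f b))) b"
    using occurs_at_end_exists by blast
  then have "symbol_upto y n = b"
    unfolding symbol_upto_def by (rule the_equality) (metis b occurs_at_end_unique)
  with b show ?thesis by (metis occurs_at_end_unique)
qed

lemma occurs_at_symbol_from: "occurs_at f y n (symbol_from y n)"
  by (simp flip: symbol_from_eq_iff)

lemma occurs_at_symbol_upto:
  "occurs_at f y (n - int (length (f (symbol_upto y n)))) (symbol_upto y n)"
  by (simp flip: symbol_upto_eq_iff)

definition next_cut :: "(int \<Rightarrow> 'y) \<Rightarrow> int \<Rightarrow> int" where
  "next_cut y n = n + int (length (f (symbol_from y n)))"

definition prev_cut :: "(int \<Rightarrow> 'y) \<Rightarrow> int \<Rightarrow> int" where
  "prev_cut y n = n - int (length (f (symbol_upto y n)))"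

text \<open>The word that ends just before \<open>n\<close> is also the unique word that begins where it begins, so
  parsing forward retraces a step of parsing backward. This makes the right and the left half of the
  parse fit into one two-sided sequence of cuts.\<close>

lemma next_cut_prev_cut: "next_cut y (prev_cut y n) = n"
proof -
  have "symbol_from y (prev_cut y n) = symbol_upto y n"
    by (simp add: symbol_from_eq_iff prev_cut_def occurs_at_symbol_upto)
  then show ?thesis by (simp add: next_cut_def prev_cut_def)
qed

text \<open>The coordinate at which the \<open>i\<close>-th block of the parse of \<open>y\<close> begins; block 1 begins at coordinate 1,
  as in \<open>block_start\<close>.\<close>

definition cut :: "(int \<Rightarrow> 'y) \<Rightarrow> int \<Rightarrow> int" where
  "cut y i = (if 1 \<le> i then (next_cut y ^^ nat (i - 1)) 1 else (prev_cut y ^^ nat (1 - i)) 1)"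

definition decode :: "(int \<Rightarrow> 'y) \<Rightarrow> int \<Rightarrow> 'x" where
  "decode y i = symbol_from y (cut y i)"

lemma cut_step: "cut y (i + 1) = next_cut y (cut y i)"
proof (cases "1 \<le> i")
  case True
  then have "nat (i + 1 - 1) = Suc (nat (i - 1))" by simp
  with True show ?thesis by (simp add: cut_def)
next
  case False
  then have "nat (1 - i) = Suc (nat (1 - (i + 1)))" by simp
  moreover have "cut y (i + 1) = (prev_cut y ^^ nat (1 - (i + 1))) 1"
    using False by (auto simp: cut_def)
  ultimately show ?thesis using False by (simp add: cut_def next_cut_prev_cut)
qed

text \<open>Both sides are 1 for \<open>i = 1\<close> and grow by the length of the word of \<open>decode y i\<close>.\<close>

lemma block_start_decode: "block_start f (decode y) i = cut y i"
proof (induction i rule: int_induct[where k = 1])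
  case base
  then show ?case by (simp add: block_start_1 cut_def)
next
  case (step1 i)
  then show ?case by (simp add: block_start_step cut_step next_cut_def decode_def)
next
  case (step2 i)
  then show ?case
    using block_start_step[of f "decode y" "i - 1"] cut_step[of y "i - 1"]
    by (simp add: next_cut_def decode_def[of y "i - 1"])
qed

section \<open>The two-sided concatenation is a bijection\<close>

lemma block_start_strict_mono: "strict_mono (block_start f x)"
proof (rule strict_monoI)
  fix i j :: int
  assume "i < j"
  then show "block_start f x i < block_start f x j"
  proof (induction j rule: int_gr_induct)
    case base
    then show ?case by (simp add: block_start_step code_nonempty)
  next
    case (step j)
    then show ?case by (simp add: block_start_step)
  qed
qed

lemma two_sided_concat_nth:
  assumes "k < length (f (x i))"
  shows "two_sided_concat f x (block_start f x i + int k) = f (x i) ! k"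
proof -
  let ?n = "block_start f x i + int k"
  have "(THE j. block_start f x j \<le> ?n \<and> ?n < block_start f x (j + 1)) = i"
  proof (rule the_equality)
    show "block_start f x i \<le> ?n \<and> ?n < block_start f x (i + 1)"
      using assms by (simp add: block_start_step)
  next
    fix j
    assume j: "block_start f x j \<le> ?n \<and> ?n < block_start f x (j + 1)"
    have "block_start f x j < block_start f x (i + 1)"
      using j assms by (simp add: block_start_step)
    moreover have "block_start f x i < block_start f x (j + 1)"
      using j by linarith
    ultimately have "j < i + 1" "i < j + 1"
      using strict_mono_less[OF block_start_strict_mono] by blast+
    then show "j = i" by linarith
  qed
  then show ?thesis by (simp add: two_sided_concat_def)
qed

lemma occurs_at_two_sided_concat: "occurs_at f (two_sided_concat f x) (block_start f x i) (x i)"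
  by (simp add: occurs_at_def two_sided_concat_nth)

text \<open>Block starts are strictly increasing integers, hence unbounded in both directions, so every
  coordinate lies between two consecutive ones.\<close>

lemma block_covers:
  obtains i k where "n = block_start f x i + int k" "k < length (f (x i))"
proof -
  have up: "block_start f x (1 + int m) \<ge> 1 + int m" for m
  proof (induction m)
    case (Suc m)
    have "block_start f x (1 + int m) < block_start f x (1 + int (Suc m))"
      using block_start_strict_mono by (rule strict_monoD) simp
    with Suc show ?case by simp
  qed (simp add: block_start_1)
  have down: "block_start f x (1 - int m) \<le> 1 - int m" for m
  proof (induction m)
    case (Suc m)
    have "block_start f x (1 - int (Suc m)) < block_start f x (1 - int m)"
      using block_start_strict_mono by (rule strict_monoD) simp
    with Suc show ?case by simp
  qed (simp add: block_start_1)
  \<comment> \<open>\<open>l\<close> is \<open>min 1 n\<close>. A block with index \<open>l \<le> 1\<close> begins at or before coordinate \<open>l\<close>, thus before \<open>n + 1\<close>.\<close>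
  define l where "l = 1 - int (nat (1 - n))"
  have "block_start f x l \<le> n"
    using down[of "nat (1 - n)"] up[of 0] unfolding l_def by linarith
  define P where "P m \<longleftrightarrow> n < block_start f x (l + int m)" for m
  have "\<not> P 0"
    using \<open>block_start f x l \<le> n\<close> by (simp add: P_def)
  \<comment> \<open>Block \<open>1 + max n 0\<close> begins after \<open>n\<close>.\<close>
  moreover have "P (nat (1 + int (nat n) - l))"
    using up[of "nat n"] unfolding P_def l_def by (simp split: if_splits)
  ultimately obtain m where "\<not> P m" "P (Suc m)"
    using ex_least_nat_less by blast
  then have "block_start f x (l + int m) \<le> n"
    "n < block_start f x (l + int m) + int (length (f (x (l + int m))))"
    using block_start_step[of f x "l + int m"] by (auto simp: P_def add_ac)
  then show thesis
    by (intro that[of "l + int m" "nat (n - block_start f x (l + int m))"]) auto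
qed

lemma two_sided_concat_decode: "two_sided_concat f (decode y) = y"
proof
  fix n
  obtain i k where ik: "n = block_start f (decode y) i + int k" "k < length (f (decode y i))"
    by (rule block_covers)
  have "occurs_at f y (cut y i) (decode y i)"
    by (simp add: decode_def occurs_at_symbol_from)
  then show "two_sided_concat f (decode y) n = y n"
    using ik by (simp add: two_sided_concat_nth) (simp add: block_start_decode occurs_at_def)
qed

text \<open>The block \<open>f (x i)\<close> is a code word beginning at its block start and ending just before the next one.
  Since such words are unique, the forward and the backward parse both recover the blocks of \<open>x\<close>.\<close>

lemma decode_two_sided_concat: "decode (two_sided_concat f x) = x"
proof -
  let ?y = "two_sided_concat f x"
  have from_eq: "symbol_from ?y (block_start f x i) = x i" for i
    using occurs_at_two_sided_concat by (simp add: symbol_from_eq_iff)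
  have upto_eq: "symbol_upto ?y (block_start f x (i + 1)) = x i" for i
    using occurs_at_two_sided_concat[of x i] by (simp add: symbol_upto_eq_iff block_start_step)
  have fwd: "cut ?y (1 + int m) = block_start f x (1 + int m)" for m
  proof (induction m)
    case (Suc m)
    then show ?case
      using cut_step[of ?y "1 + int m"] block_start_step[of f x "1 + int m"]
      by (simp add: next_cut_def from_eq add_ac)
  qed (simp add: cut_def block_start_1)
  have bwd: "cut ?y (1 - int m) = block_start f x (1 - int m)" for m
  proof (induction m)
    case (Suc m)
    have "cut ?y (1 - int (Suc m)) = prev_cut ?y (cut ?y (1 - int m))"
    proof -
      have "nat (1 - (1 - int (Suc m))) = Suc m" "nat (1 - (1 - int m)) = m" by simp_all
      then show ?thesis by (cases m) (auto simp: cut_def)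
    qed
    also have "\<dots> = block_start f x (1 - int (Suc m))"
      using upto_eq[of "- int m"] block_start_step[of f x "- int m"]
      by (simp add: Suc prev_cut_def)
    finally show ?case .
  qed (simp add: cut_def block_start_1)
  have "cut ?y i = block_start f x i" for i
    using fwd[of "nat (i - 1)"] bwd[of "nat (1 - i)"] by (cases "1 \<le> i") auto
  then show ?thesis by (simp add: decode_def from_eq fun_eq_iff)
qed

lemma bij_two_sided_concat: "bij (two_sided_concat f)"
  by (rule o_bij[where g = decode])
    (simp_all add: fun_eq_iff[of "_ \<circ> _"] decode_two_sided_concat two_sided_concat_decode)

text \<open>Images of measurable sets under the concatenation are preimages under its inverse, so measurability
  of \<open>decode\<close> gives their measurability.\<close>

lemma two_sided_concat_image: "two_sided_concat f ` A = decode -` A"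
proof (intro set_eqI iffI)
  fix y
  assume "y \<in> decode -` A"
  then have "two_sided_concat f (decode y) \<in> two_sided_concat f ` A" by simp
  then show "y \<in> two_sided_concat f ` A" by (simp only: two_sided_concat_decode)
qed (auto simp: decode_two_sided_concat)

lemma block_start_shift:
  "block_start f (shift x) i = block_start f x (i + 1) - int (length (f (x 1)))"
proof (induction i rule: int_induct[where k = 1])
  case base
  then show ?case using block_start_step[of f x 1] by (simp add: block_start_1)
next
  case (step1 i)
  moreover have "shift x i = x (i + 1)" by (simp add: shift_def)
  ultimately show ?case
    using block_start_step[of f "shift x" i] block_start_step[of f x "i + 1"] by simp
next
  case (step2 i)
  moreover have "shift x (i - 1) = x i" by (simp add: shift_def)
  ultimately show ?case
    using block_start_step[of f "shift x" "i - 1"] block_start_step[of f x i] by simp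
qed

lemma funpow_shift: "(shift ^^ m) x = (\<lambda>i. x (i + int m))"
  by (induction m) (auto simp: shift_def fun_eq_iff add_ac)

text \<open>Dropping the first symbol moves the origin of the concatenation by the length of its word.\<close>

lemma two_sided_concat_shift:
  "two_sided_concat f (shift x) = (shift ^^ length (f (x 1))) (two_sided_concat f x)"
proof
  fix n
  obtain i k where ik: "n = block_start f (shift x) i + int k" "k < length (f (shift x i))"
    by (rule block_covers)
  have "two_sided_concat f (shift x) n = f (x (i + 1)) ! k"
    using ik by (simp add: two_sided_concat_nth) (simp add: shift_def)
  also have "\<dots> = two_sided_concat f x (block_start f x (i + 1) + int k)"
    using ik by (simp add: shift_def two_sided_concat_nth)
  also have "block_start f x (i + 1) + int k = n + int (length (f (x 1)))"
    using ik(1) by (simp add: block_start_shift)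
  finally show "two_sided_concat f (shift x) n
      = (shift ^^ length (f (x 1))) (two_sided_concat f x) n"
    by (simp add: funpow_shift)
qed

lemma shift_decode:
  "shift (decode y) = decode ((shift ^^ length (f (decode y 1))) y)"
  using two_sided_concat_shift[of "decode y", THEN arg_cong[where f = decode]]
  by (simp only: decode_two_sided_concat two_sided_concat_decode)

end

section \<open>Transport of stationary measures\<close>

lemma space_seq_space [simp]: "space seq_space = UNIV"
  by (simp add: seq_space_def space_PiM)

lemma coordinate_measurable: "(\<lambda>y. y n) \<in> measurable seq_space (count_space UNIV)"
  unfolding seq_space_def by (rule measurable_component_singleton) simp

lemma measurable_seq_spaceI:
  assumes "\<And>i. (\<lambda>\<omega>. g \<omega> i) \<in> measurable M (count_space UNIV)"
  shows "g \<in> measurable M seq_space"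
proof -
  have "(\<lambda>\<omega> i. g \<omega> i) \<in> measurable M (PiM UNIV (\<lambda>_. count_space UNIV))"
    by (rule measurable_PiM_single') (use assms in auto)
  then show ?thesis by (simp only: seq_space_def)
qed

lemma shift_measurable: "shift \<in> measurable seq_space seq_space"
  by (rule measurable_seq_spaceI) (simp add: shift_def coordinate_measurable)

lemma stationary_measure_funpow:
  assumes "stationary_measure \<nu>" "A \<in> sets \<nu>"
  shows "(shift ^^ m) -` A \<in> sets \<nu>" "emeasure \<nu> ((shift ^^ m) -` A) = emeasure \<nu> A"
proof -
  have sets: "sets \<nu> = sets seq_space"
    and inv: "B \<in> sets \<nu> \<Longrightarrow> emeasure \<nu> (shift -` B) = emeasure \<nu> B" for B
    using assms by (auto simp: stationary_measure_def)
  have shift_sets: "shift -` B \<in> sets \<nu>" if "B \<in> sets \<nu>" for B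
    using measurable_sets[OF shift_measurable, of B] that by (simp add: sets)
  have "(shift ^^ m) -` A \<in> sets \<nu> \<and> emeasure \<nu> ((shift ^^ m) -` A) = emeasure \<nu> A"
  proof (induction m)
    case (Suc m)
    have "(shift ^^ Suc m) -` A = shift -` ((shift ^^ m) -` A)"
      by (simp add: funpow_Suc_right vimage_comp del: funpow.simps)
    with Suc shift_sets inv show ?case by metis
  qed (use assms in simp)
  then show "(shift ^^ m) -` A \<in> sets \<nu>" "emeasure \<nu> ((shift ^^ m) -` A) = emeasure \<nu> A"
    by simp_all
qed

context complete_fix_free_code
begin

lemma occurs_at_sets: "{y. occurs_at f y n a} \<in> sets seq_space"
proof -
  have "{y. y m = c} \<in> sets seq_space" for m and c :: 'y
    using measurable_sets[OF coordinate_measurable, of "{c}" m] by (simp add: vimage_def)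
  then have "{y \<in> space seq_space. \<forall>k\<in>{..<length (f a)}. y (n + int k) = f a ! k} \<in> sets seq_space"
    by (intro sets.sets_Collect_finite_All) auto
  then show ?thesis by (simp add: occurs_at_def Ball_def)
qed

text \<open>The symbol found at \<open>n\<close> is \<open>a\<close> precisely if the finitely many letters of \<open>f a\<close> are read there.\<close>

lemma symbol_from_measurable: "(\<lambda>y. symbol_from y n) \<in> measurable seq_space (count_space UNIV)"
  by (rule measurable_count_space_eq2[THEN iffD2])
     (auto simp: vimage_def symbol_from_eq_iff occurs_at_sets)

lemma symbol_upto_measurable: "(\<lambda>y. symbol_upto y n) \<in> measurable seq_space (count_space UNIV)"
  by (rule measurable_count_space_eq2[THEN iffD2])
     (auto simp: vimage_def symbol_upto_eq_iff occurs_at_sets)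

text \<open>The starting point of the last step is itself a function of \<open>y\<close>, but it takes only countably many
  values; on each of them the step is measurable by assumption.\<close>

lemma funpow_cut_measurable:
  fixes g :: "(int \<Rightarrow> 'y) \<Rightarrow> int \<Rightarrow> int"
  assumes "\<And>n. (\<lambda>y. g y n) \<in> measurable seq_space (count_space UNIV)"
  shows "(\<lambda>y. (g y ^^ m) n) \<in> measurable seq_space (count_space UNIV)"
proof (induction m)
  case (Suc m)
  show ?case
    using measurable_compose_countable[where f = "\<lambda>k y. g y k", OF assms Suc] by simp
qed simp

lemma cut_measurable: "(\<lambda>y. cut y i) \<in> measurable seq_space (count_space UNIV)"
proof -
  have "(\<lambda>y. next_cut y n) \<in> measurable seq_space (count_space UNIV)"
    "(\<lambda>y. prev_cut y n) \<in> measurable seq_space (count_space UNIV)" for n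
    unfolding next_cut_def prev_cut_def
    by (rule measurable_compose[OF symbol_from_measurable]
        measurable_compose[OF symbol_upto_measurable], simp)+
  then show ?thesis
    unfolding cut_def by (cases "1 \<le> i") (auto intro!: funpow_cut_measurable)
qed

lemma decode_measurable: "decode \<in> measurable seq_space seq_space"
proof -
  have "(\<lambda>y. decode y i) \<in> measurable seq_space (count_space UNIV)" for i
    unfolding decode_def
    by (rule measurable_compose_countable[OF symbol_from_measurable cut_measurable])
  then show ?thesis by (rule measurable_seq_spaceI)
qed

text \<open>The set on the left is partitioned into the pieces \<open>C a\<close> by the first decoded symbol \<open>a\<close>, the set on
  the right into the pieces \<open>B a\<close> by the symbol whose word ends at coordinate 0. A shift by the fixed
  length of \<open>f a\<close> takes \<open>C a\<close> to \<open>B a\<close>.\<close>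

lemma emeasure_shift_vimage_decode:
  assumes \<nu>: "stationary_measure \<nu>" and A: "A \<in> sets seq_space"
  shows "emeasure \<nu> (decode -` (shift -` A)) = emeasure \<nu> (decode -` A)"
proof -
  have sets: "sets \<nu> = sets seq_space"
    using \<nu> by (simp add: stationary_measure_def)
  define B where "B a = decode -` A \<inter> {z. symbol_upto z 1 = a}" for a
  define C where "C a = (shift ^^ length (f a)) -` B a" for a
  have B_sets: "B a \<in> sets \<nu>" for a
  proof -
    have "decode -` A \<in> sets \<nu>"
      using measurable_sets[OF decode_measurable A] by (simp add: sets)
    then show ?thesis
      by (auto simp: B_def sets symbol_upto_eq_iff occurs_at_sets)
  qed
  have C_sets: "C a \<in> sets \<nu>" and C_emeasure: "emeasure \<nu> (C a) = emeasure \<nu> (B a)" for a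
    unfolding C_def by (intro stationary_measure_funpow[OF \<nu>] B_sets)+
  \<comment> \<open>A word that begins at coordinate 1 ends at coordinate 0 once it has been shifted by its own length.\<close>
  have decode_1: "decode y 1 = a \<longleftrightarrow> symbol_upto ((shift ^^ length (f a)) y) 1 = a" for y a
    by (simp add: decode_def cut_def symbol_from_eq_iff symbol_upto_eq_iff occurs_at_def
        funpow_shift add_ac)
  then have C_eq: "C a = decode -` (shift -` A) \<inter> {y. decode y 1 = a}" for a
    unfolding C_def B_def by (auto simp: shift_decode simp flip: decode_1)
  have "emeasure \<nu> (decode -` (shift -` A)) = emeasure \<nu> (\<Union>a\<in>UNIV. C a)"
    by (rule arg_cong[where f = "emeasure \<nu>"]) (auto simp: C_eq)
  also have "\<dots> = (\<Sum>a\<in>UNIV. emeasure \<nu> (C a))"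
    using C_sets by (subst sum_emeasure) (auto simp: disjoint_family_on_def C_eq)
  also have "\<dots> = (\<Sum>a\<in>UNIV. emeasure \<nu> (B a))"
    by (simp add: C_emeasure)
  also have "\<dots> = emeasure \<nu> (\<Union>a\<in>UNIV. B a)"
    using B_sets by (subst sum_emeasure) (auto simp: disjoint_family_on_def B_def)
  also have "(\<Union>a\<in>UNIV. B a) = decode -` A"
    by (auto simp: B_def)
  finally show ?thesis .
qed

lemma emeasure_distr_decode:
  assumes "stationary_measure \<nu>" "A \<in> sets seq_space"
  shows "emeasure (distr \<nu> seq_space decode) A = emeasure \<nu> (decode -` A)"
proof -
  have sets: "sets \<nu> = sets seq_space"
    using assms(1) by (simp add: stationary_measure_def)
  then have "decode \<in> measurable \<nu> seq_space"
    using decode_measurable by (simp cong: measurable_cong_sets)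
  then show ?thesis
    using sets_eq_imp_space_eq[OF sets] assms(2) by (simp add: emeasure_distr)
qed

lemma stationary_distr_decode:
  assumes \<nu>: "stationary_measure \<nu>"
  shows "stationary_measure (distr \<nu> seq_space decode)"
  unfolding stationary_measure_def
proof (intro conjI ballI)
  have "decode \<in> measurable \<nu> seq_space"
    using \<nu> decode_measurable by (simp add: stationary_measure_def cong: measurable_cong_sets)
  then show "prob_space (distr \<nu> seq_space decode)"
    using \<nu> by (intro prob_space.prob_space_distr) (auto simp: stationary_measure_def)
next
  fix A :: "(int \<Rightarrow> 'x) set"
  assume "A \<in> sets (distr \<nu> seq_space decode)"
  then have A: "A \<in> sets seq_space" by simp
  have "shift -` A \<in> sets seq_space"
    using measurable_sets[OF shift_measurable A] by simp
  with A \<nu> show "emeasure (distr \<nu> seq_space decode) (shift -` A)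
      = emeasure (distr \<nu> seq_space decode) A"
    by (simp add: emeasure_distr_decode emeasure_shift_vimage_decode)
qed simp

end

theorem proposition4p1:
  fixes f :: "'x::finite \<Rightarrow> 'y::finite list"
  assumes "complete_fix_free f"
    and "range f \<noteq> {[]}"
  shows "bij (two_sided_concat f) \<and>
    (\<forall>\<nu> :: (int \<Rightarrow> 'y) measure. stationary_measure \<nu> \<longrightarrow>
      (\<forall>A\<in>sets seq_space. two_sided_concat f ` A \<in> sets \<nu>) \<and>
      (\<exists>\<mu> :: (int \<Rightarrow> 'x) measure. stationary_measure \<mu> \<and>
        (\<forall>A\<in>sets seq_space. emeasure \<mu> A = emeasure \<nu> (two_sided_concat f ` A))))"
proof -
  interpret complete_fix_free_code f
    using assms by unfold_locales
  show ?thesis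
  proof (intro conjI allI impI ballI)
    show "bij (two_sided_concat f)"
      by (rule bij_two_sided_concat)
  next
    fix \<nu> :: "(int \<Rightarrow> 'y) measure" and A :: "(int \<Rightarrow> 'x) set"
    assume "stationary_measure \<nu>" "A \<in> sets seq_space"
    then show "two_sided_concat f ` A \<in> sets \<nu>"
      using measurable_sets[OF decode_measurable, of A]
      by (simp add: two_sided_concat_image stationary_measure_def)
  next
    fix \<nu> :: "(int \<Rightarrow> 'y) measure"
    assume "stationary_measure \<nu>"
    then show "\<exists>\<mu>. stationary_measure \<mu> \<and>
        (\<forall>A\<in>sets seq_space. emeasure \<mu> A = emeasure \<nu> (two_sided_concat f ` A))"
      using stationary_distr_decode emeasure_distr_decode
      by (intro exI[of _ "distr \<nu> seq_space decode"]) (simp add: two_sided_concat_image)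
  qed
qed

end
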